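(* Let $r\ge 1$, $\mathbb A=\{1,\dots,r\}$, and let $t,q$ be indeterminates. Then $$\mathrm{Ferm}(t,q)\times \mathrm{Bos}(t,q)\equiv 1 \pmod{\mathcal I(SF_q)},$$ where $\mathrm{Ferm}(t,q)$, $\mathrm{Bos}(t,q)$, $SF_q$ and $\mathcal I(SF_q)$ are as defined in the context.
   Context: A biword on $\mathbb A$ is a $2\times n$ matrix $\binom{x_1\cdots x_n}{a_1\cdots a_n}$ ($n\ge0$) with entries in $\mathbb A$. The first row is its top word and the second row its bottom word; $n$ is its length. A biword is viewed as a word in biletters $\binom{x_i}{a_i}$, and biwords are multiplied by concatenation; the empty biword is $1$. Let $\mathcal B$ be the set of biwords. Let $K=\mathbb Z[t,t^{-1},q,q^{-1}]$ and let $K\langle\langle\mathcal B\rangle\rangle$ be the algebra of formal sums $\sum_\alpha c(\alpha)\alpha$ with $c(\alpha)\in K$. There are finitely many biwords of each length, so these sums can be multiplied. For a word $w=w_1\cdots w_m$, $\mathrm{inv}\,w$ is the number of pairs $i<j$ with $w_i>w_j$, and $\overline w$ is the nondecreasing rearrangement of $w$. For a biword $\alpha=\binom{x_1\cdots x_n}{a_1\cdots a_n}$, $\mathrm{exc}\,\alpha=\#\{i: a_i>x_i\}$. Define $$\mathrm{Bos}(t,q)=\sum_{w\in\mathbb A^*} t^{\mathrm{exc}\binom{\overline w}{w}}q^{\mathrm{inv}\,w}\binom{\overline w}{w}$$ and $$\mathrm{Ferm}(t,q)=\sum_{J\subseteq\mathbb A}(-1)^{|J|}\sum_{\sigma\in\mathfrak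 S_J} t^{\mathrm{exc}\,\alpha_\sigma}(-q)^{-\mathrm{inv}\,\sigma}\,\alpha_\sigma .$$ Here $J=\{i_1<\dots<i_l\}$, $\mathfrak S_J$ is the group of permutations of $J$, $\alpha_\sigma=\binom{\sigma(i_1)\cdots\sigma(i_l)}{i_1\cdots i_l}$, and $\mathrm{inv}\,\sigma=\mathrm{inv}(\sigma(i_1)\cdots\sigma(i_l))$. The term $J=\emptyset$ contributes $1$. The reduction system $SF_q$ consists of the following rules, for all $x>y$ in $\mathbb A$: - $\binom{xy}{ab}\to\binom{yx}{ba}$ if $a>b$; - $\binom{xy}{ab}\to q\binom{yx}{ba}$ if $a=b$; - $\binom{xy}{ab}\to q^2\binom{yx}{ba}$ if $a<b$. $\mathcal I(SF_q)$ is the two-sided ideal generated by the differences (left side minus right side) of these rules. $E\equiv F\pmod{\mathcal I(SF_q)}$ means that, for every $n$, the (finite) length-$n$ homogeneous component of $E-F$ lies in this ideal. *)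

theory Defs
  imports
    "HOL-Algebra.Ideal"
    "HOL-Combinatorics.Permutations"
    "HOL-Library.Poly_Mapping"
    "HOL-Library.Product_Plus"
begin

text \<open>Laurent polynomials: the exponent pair \<open>(i, j)\<close> stands for the monomial \<open>t^i q^j\<close>.\<close>

type_synonym laurent = "(int \<times> int) \<Rightarrow>\<^sub>0 int"

definition K_t :: laurent where "K_t = Poly_Mapping.single (1, 0) 1"
definition K_q :: laurent where "K_q = Poly_Mapping.single (0, 1) 1"
definition K_qinv :: laurent where "K_qinv = Poly_Mapping.single (0, -1) 1"

lemma K_q_mult_K_qinv: "K_q * K_qinv = 1"
  by (simp add: K_q_def K_qinv_def mult_single flip: zero_prod_def)

lemma neg_K_q_mult_neg_K_qinv: "(- K_q) * (- K_qinv) = 1"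
  by (simp add: K_q_mult_K_qinv)


text \<open>The biletter with top \<open>x\<close> and bottom \<open>a\<close> is the pair \<open>(x, a)\<close>.\<close>

type_synonym biword = "(nat \<times> nat) list"

definition biwords :: "nat \<Rightarrow> biword set"
  where "biwords r = lists ({1..r} \<times> {1..r})"

definition inv_word :: "nat list \<Rightarrow> nat"
  where "inv_word w = card {(i, j). i < j \<and> j < length w \<and> w ! i > w ! j}"

definition exc :: "biword \<Rightarrow> nat"
  where "exc \<alpha> = card {i. i < length \<alpha> \<and> snd (\<alpha> ! i) > fst (\<alpha> ! i)}"


text \<open>A formal sum of biwords is its coefficient function.\<close>

type_synonym biseries = "biword \<Rightarrow> laurent"

definition bw_term :: "laurent \<Rightarrow> biword \<Rightarrow> biseries"
  where "bw_term c \<alpha> = (\<lambda>\<beta>. if \<beta> = \<alpha> then c else 0)"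

definition bw_mult :: "biseries \<Rightarrow> biseries \<Rightarrow> biseries"  (infixl \<open>\<star>\<close> 70)
  where "E \<star> F = (\<lambda>\<alpha>. \<Sum>(\<beta>, \<gamma>) \<in> {(\<beta>, \<gamma>). \<beta> @ \<gamma> = \<alpha>}. E \<beta> * F \<gamma>)"

text \<open>\<open>formal_sum I c b\<close> is the sum of \<open>c i\<close> times the biword \<open>b i\<close> over \<open>i\<close> in \<open>I\<close>.
  It is used only when each biword is \<open>b i\<close> for finitely many \<open>i\<close> in \<open>I\<close>.\<close>

definition formal_sum :: "'i set \<Rightarrow> ('i \<Rightarrow> laurent) \<Rightarrow> ('i \<Rightarrow> biword) \<Rightarrow> biseries"
  where "formal_sum I c b = (\<lambda>\<alpha>. \<Sum>i \<in> {i \<in> I. b i = \<alpha>}. c i)"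

definition Bos :: "nat \<Rightarrow> biseries"
  where "Bos r = formal_sum (lists {1..r})
           (\<lambda>w. K_t ^ exc (zip (sort w) w) * K_q ^ inv_word w)
           (\<lambda>w. zip (sort w) w)"

definition perm_biword :: "nat set \<Rightarrow> (nat \<Rightarrow> nat) \<Rightarrow> biword"
  where "perm_biword J \<sigma> = map (\<lambda>i. (\<sigma> i, i)) (sorted_list_of_set J)"

definition inv_perm :: "nat set \<Rightarrow> (nat \<Rightarrow> nat) \<Rightarrow> nat"
  where "inv_perm J \<sigma> = inv_word (map \<sigma> (sorted_list_of_set J))"

text \<open>\<open>(- q)^(-k)\<close> is written as the \<open>k\<close>-th power of \<open>- q^(-1)\<close>, the inverse of \<open>- q\<close>.\<close>

definition Ferm :: "nat \<Rightarrow> biseries"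
  where "Ferm r = (\<lambda>\<alpha>. \<Sum>J \<in> Pow {1..r}. (-1) ^ card J *
           formal_sum {\<sigma>. \<sigma> permutes J}
             (\<lambda>\<sigma>. K_t ^ exc (perm_biword J \<sigma>) * (- K_qinv) ^ inv_perm J \<sigma>)
             (perm_biword J) \<alpha>)"


text \<open>The algebra of finite formal sums of biwords.\<close>

definition bw_algebra :: "nat \<Rightarrow> biseries ring"
  where "bw_algebra r =
    \<lparr>carrier = {E. finite {\<alpha>. E \<alpha> \<noteq> 0} \<and> {\<alpha>. E \<alpha> \<noteq> 0} \<subseteq> biwords r},
     monoid.mult = (\<star>), one = bw_term 1 [],
     zero = (\<lambda>_. 0), add = (\<lambda>E F \<alpha>. E \<alpha> + F \<alpha>)\<rparr>"

text \<open>A triple \<open>(\<alpha>, c, \<beta>)\<close> is the rule rewriting \<open>\<alpha>\<close> to \<open>c\<close> times \<open>\<beta>\<close>.\<close>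

inductive_set SF_q :: "nat \<Rightarrow> (biword \<times> laurent \<times> biword) set" for r
  where
    "\<lbrakk>x \<in> {1..r}; y \<in> {1..r}; a \<in> {1..r}; b \<in> {1..r}; x > y; a > b\<rbrakk>
      \<Longrightarrow> ([(x, a), (y, b)], 1, [(y, b), (x, a)]) \<in> SF_q r"
  | "\<lbrakk>x \<in> {1..r}; y \<in> {1..r}; a \<in> {1..r}; b \<in> {1..r}; x > y; a = b\<rbrakk>
      \<Longrightarrow> ([(x, a), (y, b)], K_q, [(y, b), (x, a)]) \<in> SF_q r"
  | "\<lbrakk>x \<in> {1..r}; y \<in> {1..r}; a \<in> {1..r}; b \<in> {1..r}; x > y; a < b\<rbrakk>
      \<Longrightarrow> ([(x, a), (y, b)], K_q ^ 2, [(y, b), (x, a)]) \<in> SF_q r"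

definition rule_diffs :: "(biword \<times> laurent \<times> biword) set \<Rightarrow> biseries set"
  where "rule_diffs R = {(\<lambda>\<gamma>. bw_term 1 \<alpha> \<gamma> - bw_term c \<beta> \<gamma>) | \<alpha> c \<beta>. (\<alpha>, c, \<beta>) \<in> R}"

definition I_SF_q :: "nat \<Rightarrow> biseries set"
  where "I_SF_q r = Idl\<^bsub>bw_algebra r\<^esub> (rule_diffs (SF_q r))"

definition hom_component :: "nat \<Rightarrow> biseries \<Rightarrow> biseries"
  where "hom_component n E = (\<lambda>\<alpha>. if length \<alpha> = n then E \<alpha> else 0)"

definition cong_SF_q :: "nat \<Rightarrow> biseries \<Rightarrow> biseries \<Rightarrow> bool"
  where "cong_SF_q r E F \<longleftrightarrow>
    (\<forall>n. hom_component n (\<lambda>\<alpha>. E \<alpha> - F \<alpha>) \<in> I_SF_q r)"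


text \<open>\<open>genideal\<close> is an intersection of ideals, and would be the whole type if there were no ideal
  containing the generators; the following facts rule this out.\<close>

lemma finite_splits: "finite {(\<beta>, \<gamma>). \<beta> @ \<gamma> = (\<alpha> :: 'a list)}"
proof -
  have "{(\<beta>, \<gamma>). \<beta> @ \<gamma> = \<alpha>} \<subseteq> (\<lambda>k. (take k \<alpha>, drop k \<alpha>)) ` {..length \<alpha>}"
  proof clarify
    fix \<beta> \<gamma> :: "'a list"
    show "(\<beta>, \<gamma>) \<in> (\<lambda>k. (take k (\<beta> @ \<gamma>), drop k (\<beta> @ \<gamma>))) ` {..length (\<beta> @ \<gamma>)}"
      by (rule image_eqI[of _ _ "length \<beta>"]) simp_all
  qed
  then show ?thesis
    by (rule finite_subset) simp
qed

lemma bw_mult_assoc: "(E \<star> F) \<star> G = E \<star> (F \<star> G)"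
proof
  fix \<alpha>
  let ?S = "\<lambda>\<alpha>::biword. {(\<beta>, \<gamma>). \<beta> @ \<gamma> = \<alpha>}"
  have "((E \<star> F) \<star> G) \<alpha> = (\<Sum>p \<in> ?S \<alpha>. \<Sum>s \<in> ?S (fst p). E (fst s) * F (snd s) * G (snd p))"
    by (simp add: bw_mult_def split_def sum_distrib_right)
  also have "\<dots> = (\<Sum>(p, s) \<in> Sigma (?S \<alpha>) (\<lambda>p. ?S (fst p)). E (fst s) * F (snd s) * G (snd p))"
    by (subst sum.Sigma) (auto simp: finite_splits)
  also have "\<dots> = (\<Sum>(p, s) \<in> Sigma (?S \<alpha>) (\<lambda>p. ?S (snd p)). E (fst p) * (F (fst s) * G (snd s)))"
    by (rule sum.reindex_bij_witness
        [where i = "\<lambda>((a, _), (b, c)). ((a @ b, c), (a, b))"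
           and j = "\<lambda>((_, c), (a, b)). ((a, b @ c), (b, c))"])
      (auto simp: mult.assoc)
  also have "\<dots> = (\<Sum>p \<in> ?S \<alpha>. \<Sum>s \<in> ?S (snd p). E (fst p) * (F (fst s) * G (snd s)))"
    by (subst sum.Sigma) (auto simp: finite_splits)
  also have "\<dots> = (E \<star> (F \<star> G)) \<alpha>"
    by (simp add: bw_mult_def split_def sum_distrib_left)
  finally show "((E \<star> F) \<star> G) \<alpha> = (E \<star> (F \<star> G)) \<alpha>" .
qed

lemma bw_mult_one_left: "bw_term 1 [] \<star> E = E"
proof
  fix \<alpha>
  have "(bw_term 1 [] \<star> E) \<alpha> = (\<Sum>(\<beta>, \<gamma>) \<in> {([], \<alpha>)}. bw_term 1 [] \<beta> * E \<gamma>)"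
    unfolding bw_mult_def
    by (rule sum.mono_neutral_right) (auto simp: finite_splits bw_term_def split: if_splits)
  then show "(bw_term 1 [] \<star> E) \<alpha> = E \<alpha>"
    by (simp add: bw_term_def)
qed

lemma bw_mult_one_right: "E \<star> bw_term 1 [] = E"
proof
  fix \<alpha>
  have "(E \<star> bw_term 1 []) \<alpha> = (\<Sum>(\<beta>, \<gamma>) \<in> {(\<alpha>, [])}. E \<beta> * bw_term 1 [] \<gamma>)"
    unfolding bw_mult_def
    by (rule sum.mono_neutral_right) (auto simp: finite_splits bw_term_def split: if_splits)
  then show "(E \<star> bw_term 1 []) \<alpha> = E \<alpha>"
    by (simp add: bw_term_def)
qed

lemma bw_mult_support:
  "{\<alpha>. (E \<star> F) \<alpha> \<noteq> 0} \<subseteq> (\<lambda>(\<beta>, \<gamma>). \<beta> @ \<gamma>) ` ({\<beta>. E \<beta> \<noteq> 0} \<times> {\<gamma>. F \<gamma> \<noteq> 0})"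
proof
  fix \<alpha>
  assume "\<alpha> \<in> {\<alpha>. (E \<star> F) \<alpha> \<noteq> 0}"
  then obtain p where "p \<in> {(\<beta>, \<gamma>). \<beta> @ \<gamma> = \<alpha>}" "(case p of (\<beta>, \<gamma>) \<Rightarrow> E \<beta> * F \<gamma>) \<noteq> 0"
    unfolding bw_mult_def by (metis (mono_tags, lifting) mem_Collect_eq sum.neutral)
  then obtain \<beta> \<gamma> where "\<beta> @ \<gamma> = \<alpha>" "E \<beta> * F \<gamma> \<noteq> 0"
    by auto
  moreover from this have "E \<beta> \<noteq> 0" "F \<gamma> \<noteq> 0"
    by auto
  ultimately show "\<alpha> \<in> (\<lambda>(\<beta>, \<gamma>). \<beta> @ \<gamma>) ` ({\<beta>. E \<beta> \<noteq> 0} \<times> {\<gamma>. F \<gamma> \<noteq> 0})"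
    by force
qed

lemma bw_algebra_ring: "ring (bw_algebra r)"
proof (rule ringI)
  show "abelian_group (bw_algebra r)"
  proof (rule abelian_groupI)
    fix E F
    assume EF: "E \<in> carrier (bw_algebra r)" "F \<in> carrier (bw_algebra r)"
    have "{\<alpha>. E \<alpha> + F \<alpha> \<noteq> 0} \<subseteq> {\<alpha>. E \<alpha> \<noteq> 0} \<union> {\<alpha>. F \<alpha> \<noteq> 0}"
      by auto
    with EF show "E \<oplus>\<^bsub>bw_algebra r\<^esub> F \<in> carrier (bw_algebra r)"
      by (auto simp: bw_algebra_def intro: finite_subset)
  next
    fix E
    assume "E \<in> carrier (bw_algebra r)"
    then show "\<exists>F \<in> carrier (bw_algebra r). F \<oplus>\<^bsub>bw_algebra r\<^esub> E = \<zero>\<^bsub>bw_algebra r\<^esub>"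
      by (intro bexI[of _ "\<lambda>\<alpha>. - E \<alpha>"]) (auto simp: bw_algebra_def)
  qed (auto simp: bw_algebra_def add_ac)
next
  show "monoid (bw_algebra r)"
  proof (rule monoidI)
    fix E F
    assume EF: "E \<in> carrier (bw_algebra r)" "F \<in> carrier (bw_algebra r)"
    have "finite {\<alpha>. (E \<star> F) \<alpha> \<noteq> 0}"
      by (rule finite_subset[OF bw_mult_support]) (use EF in \<open>auto simp: bw_algebra_def\<close>)
    moreover have "{\<alpha>. (E \<star> F) \<alpha> \<noteq> 0} \<subseteq> biwords r"
      by (rule subset_trans[OF bw_mult_support])
        (use EF in \<open>force simp: bw_algebra_def biwords_def\<close>)
    ultimately show "E \<otimes>\<^bsub>bw_algebra r\<^esub> F \<in> carrier (bw_algebra r)"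
      by (simp add: bw_algebra_def)
  next
    have "{\<alpha>. bw_term 1 [] \<alpha> \<noteq> 0} = {[]}"
      by (auto simp: bw_term_def)
    then show "\<one>\<^bsub>bw_algebra r\<^esub> \<in> carrier (bw_algebra r)"
      by (simp add: bw_algebra_def biwords_def)
  qed (simp_all add: bw_algebra_def bw_mult_assoc bw_mult_one_left bw_mult_one_right)
qed (auto simp: bw_algebra_def bw_mult_def split_def algebra_simps sum.distrib)

lemma rule_diffs_carrier: "rule_diffs (SF_q r) \<subseteq> carrier (bw_algebra r)"
proof
  fix E
  assume "E \<in> rule_diffs (SF_q r)"
  then obtain \<alpha> c \<beta> where R: "(\<alpha>, c, \<beta>) \<in> SF_q r"
    and E: "E = (\<lambda>\<gamma>. bw_term 1 \<alpha> \<gamma> - bw_term c \<beta> \<gamma>)"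
    by (auto simp: rule_diffs_def)
  have sub: "{\<gamma>. E \<gamma> \<noteq> 0} \<subseteq> {\<alpha>, \<beta>}"
    by (auto simp: E bw_term_def split: if_splits)
  moreover have "{\<alpha>, \<beta>} \<subseteq> biwords r"
    using R by cases (auto simp: biwords_def)
  ultimately show "E \<in> carrier (bw_algebra r)"
    by (auto simp: bw_algebra_def intro: finite_subset[OF sub])
qed

lemma I_SF_q_ideal: "ideal (I_SF_q r) (bw_algebra r)"
  unfolding I_SF_q_def
  by (rule ring.genideal_ideal[OF bw_algebra_ring rule_diffs_carrier])

end

theory Submission
  imports Defs "HOL-Combinatorics.Cycles" "HOL-Combinatorics.Orbits"
begin

text \<open>Modulo the ideal, a biword \<open>\<alpha>\<close> equals \<open>q^(inv top \<alpha> - inv bottom \<alpha> + inv bottom \<beta>) \<beta>\<close>, where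
  \<open>\<beta>\<close> is its stable rearrangement with nondecreasing top word. In the product of the two series, a
  triple \<open>(J, \<sigma>, w)\<close> then contributes \<open>(-1)^|J| sign \<sigma> t^(exc \<beta>) q^(inv bottom \<beta>) \<beta>\<close>. For a fixed
  \<open>\<beta>\<close> the possible triples correspond to the sets \<open>J\<close> permuted by the map \<open>f\<close> that sends \<open>y\<close> to the
  first bottom letter below a \<open>y\<close> of the top word, and \<open>\<sigma>\<close> is the inverse of \<open>f\<close> on \<open>J\<close>. These sets
  are the unions of cycles of \<open>f\<close>, and \<open>(-1)^|J| sign \<sigma>\<close> is \<open>-1\<close> to the number of cycles in \<open>J\<close>. As
  \<open>f\<close> has a cycle whenever \<open>\<beta>\<close> is not empty, these signs cancel.\<close>

subsection \<open>Inversions and signs\<close>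

lemma inv_word_Nil [simp]: "inv_word [] = 0"
  by (simp add: inv_word_def)

lemma inv_word_Cons: "inv_word (x # w) = length (filter (\<lambda>y. y < x) w) + inv_word w"
proof -
  let ?A = "{j. j < length w \<and> w ! j < x}"
  let ?I = "{(i, j). i < j \<and> j < length w \<and> w ! i > w ! j}"
  have fin: "finite ?A" "finite ?I"
    by (simp, rule finite_subset[of _ "{..<length w} \<times> {..<length w}"]) auto
  have eq: "{(i, j). i < j \<and> j < length (x # w) \<and> (x # w) ! i > (x # w) ! j} =
      (\<lambda>j. (0, Suc j)) ` ?A \<union> map_prod Suc Suc ` ?I" (is "?L = ?R")
  proof (intro Set.set_eqI iffI)
    fix p
    assume "p \<in> ?L"
    then show "p \<in> ?R"
      by (cases p; cases "fst p"; cases "snd p") force+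
  qed auto
  have "card ?L = card ((\<lambda>j. (0::nat, Suc j)) ` ?A) + card (map_prod Suc Suc ` ?I)"
    unfolding eq by (rule card_Un_disjoint) (use fin in auto)
  also have "\<dots> = card ?A + card ?I"
    by (subst (1 2) card_image) (auto simp: inj_on_def)
  finally show ?thesis
    by (simp add: inv_word_def length_filter_conv_card)
qed

lemma inv_word_append:
  "inv_word (u @ v) = inv_word u + inv_word v + (\<Sum>x\<leftarrow>u. length (filter (\<lambda>y. y < x) v))"
  by (induction u) (simp_all add: inv_word_Cons)

text \<open>Only the pair formed by the two adjacent letters changes its order; every other pair
  keeps it. Integers are used because the change can be negative.\<close>

lemma inv_word_swap:
  "int (inv_word (u @ a # b # v)) =
    int (inv_word (u @ b # a # v)) + of_bool (b < a) - of_bool (a < b)"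
proof -
  have "(\<Sum>x\<leftarrow>u. length (filter (\<lambda>y. y < x) (a # b # v))) =
      (\<Sum>x\<leftarrow>u. length (filter (\<lambda>y. y < x) (b # a # v)))"
    by (intro arg_cong[of _ _ sum_list] map_cong) auto
  then show ?thesis
    by (simp add: inv_word_append inv_word_Cons del: filter.simps(2)) (simp add: inv_word_Cons)
qed

lemma inv_word_sorted: "sorted w \<Longrightarrow> inv_word w = 0"
  by (induction w) (auto simp: inv_word_Cons filter_empty_conv)

lemma not_sorted_descentE:
  assumes "\<not> sorted (map f w)"
  obtains u a b v where "w = u @ a # b # v" "f b < f a"
proof -
  have "\<exists>u a b v. w = u @ a # b # v \<and> f b < f a"
    using assms
  proof (induction w)
    case (Cons x w)
    show ?case
    proof (cases "sorted (map f w)")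
      case True
      with Cons.prems obtain y w' where w: "w = y # w'" "f y < f x"
        by (cases w) (auto simp: not_le dest: order_trans)
      then show ?thesis
        by (metis append_Nil)
    next
      case False
      then show ?thesis
        using Cons.IH by (metis append_Cons)
    qed
  qed simp
  then show ?thesis
    using that by blast
qed

text \<open>As long as the image word has a descent, precomposing \<open>\<sigma>\<close> with the
  transposition of the two adjacent arguments removes exactly one inversion and flips the sign. A
  sorted image word forces \<open>\<sigma> = id\<close>.\<close>

lemma sign_eq_inv_word:
  assumes "\<sigma> permutes set s" "sorted s" "distinct s"
  shows "sign \<sigma> = (- 1) ^ inv_word (map \<sigma> s)"
  using assms(1)
proof (induction "inv_word (map \<sigma> s)" arbitrary: \<sigma> rule: less_induct)
  case less
  have perm: "permutation \<sigma>"
    using less.prems by (auto simp: permutation_permutes)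
  show ?case
  proof (cases "sorted (map \<sigma> s)")
    case True
    have "map \<sigma> s = s"
      using assms less.prems True
      by (intro sorted_distinct_set_unique)
        (auto simp: distinct_map permutes_image permutes_inj_on)
    then have "\<sigma> x = x" for x
      using less.prems by (cases "x \<in> set s") (auto simp: permutes_not_in map_eq_conv[of _ _ id, simplified])
    then have "\<sigma> = id"
      by auto
    then show ?thesis
      using assms by (simp add: inv_word_sorted)
  next
    case False
    then obtain u a b v where s: "s = u @ a # b # v" and ab: "\<sigma> b < \<sigma> a"
      by (rule not_sorted_descentE)
    let ?\<tau> = "\<sigma> \<circ> transpose a b"
    have uv: "transpose a b x = x" if "x \<in> set u \<union> set v" for x
      using that assms(3) s by (auto simp: transpose_def)
    have map: "map ?\<tau> s = map \<sigma> u @ \<sigma> b # \<sigma> a # map \<sigma> v"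
      using uv by (auto simp: s)
    have inv: "inv_word (map \<sigma> s) = Suc (inv_word (map ?\<tau> s))"
      using inv_word_swap[of "map \<sigma> u" "\<sigma> a" "\<sigma> b" "map \<sigma> v"] ab unfolding map by (simp add: s)
    have "?\<tau> permutes set s"
      using less.prems by (intro permutes_compose permutes_swap_id) (auto simp: s)
    from less.hyps[OF _ this] inv have "sign ?\<tau> = (- 1) ^ inv_word (map ?\<tau> s)"
      by simp
    moreover have "sign ?\<tau> = - sign \<sigma>"
      using ab by (auto simp: sign_compose perm permutation_swap_id sign_swap_id)
    ultimately show ?thesis
      by (simp add: inv)
  qed
qed

section \<open>Cycles of a self-map and the sets it permutes\<close>

lemma sign_cycle_of_list: "cs \<noteq> [] \<Longrightarrow> distinct cs \<Longrightarrow> sign (cycle_of_list cs) = - ((- 1) ^ length cs)"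
  by (induction cs rule: cycle_of_list.induct)
    (auto simp: sign_compose permutation_swap_id permutation_of_cycle sign_swap_id)

text \<open>Each point of \<open>C\<close> lies in its own orbit, so it is an image of a point of
  \<open>C\<close>; a surjection of a finite set onto itself is injective.\<close>

lemma cyclic_on_bij_betw:
  assumes "cyclic_on f C"
  shows "bij_betw f C C"
proof -
  have sub: "f ` C \<subseteq> C"
    using cyclic_on_inI[OF assms] by blast
  have "C \<subseteq> f ` C"
  proof
    fix t
    assume "t \<in> C"
    then have "t \<in> orbit f t" "orbit f t = C"
      using assms by (auto simp: orbit_cyclic_eq3)
    then show "t \<in> f ` C"
      by (metis imageI orbit.simps)
  qed
  with sub show ?thesis
    using finite_surj_inj[OF finite_cyclic_on[OF assms]] by (auto simp: bij_betw_def)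
qed

text \<open>Listing \<open>C\<close> as \<open>s, f s, f (f s), ...\<close> identifies the
  restriction with \<open>cycle_of_list\<close>, whose sign is known.\<close>

lemma sign_cyclic_on:
  assumes "cyclic_on f C"
  shows "sign (perm_restrict f C) = - ((- 1) ^ card C)"
proof -
  obtain s where s: "s \<in> C" "C = orbit f s"
    using assms by (auto simp: cyclic_on_def)
  define n where "n = funpow_dist1 f s s"
  define cs where "cs = map (\<lambda>i. (f ^^ i) s) [0..<n]"
  have so: "s \<in> orbit f s"
    using s by simp
  have n0: "n > 0"
    by (simp add: n_def)
  have fn: "(f ^^ n) s = s"
    unfolding n_def by (rule funpow_dist1_prop[OF so])
  have set: "set cs = C"
    using orbit_conv_funpow_dist1[OF so] unfolding cs_def s(2) n_def by (simp del: upt_Suc)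
  have dist: "distinct cs"
    using inj_on_funpow_dist1[OF so] unfolding cs_def n_def by (simp add: distinct_map del: upt_Suc)
  have card: "card C = length cs"
    using distinct_card[OF dist] set by simp
  have rot: "map (cycle_of_list cs) cs = rotate1 cs"
    using cyclic_rotation[OF dist, of 1] by simp
  have "cycle_of_list cs x = perm_restrict f C x" for x
  proof (cases "x \<in> C")
    case True
    then obtain i where i: "i < n" "x = (f ^^ i) s"
      using set by (auto simp: cs_def)
    have "cycle_of_list cs (cs ! i) = rotate1 cs ! i"
      using rot i by (metis cs_def length_map length_upt minus_nat.diff_0 nth_map)
    also have "\<dots> = cs ! (Suc i mod n)"
      using i by (simp add: nth_rotate1 cs_def)
    \<comment> \<open>At the last index the rotation wraps around to \<open>s\<close>, which agrees
      with \<open>f\<close> because \<open>(f ^^ n) s = s\<close>.\<close>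
    also have "\<dots> = (f ^^ Suc i) s"
      using n0 fn by (simp add: cs_def funpow_mod_eq del: funpow.simps)
    finally show ?thesis
      using True i by (simp add: cs_def perm_restrict_simps)
  next
    case False
    then show ?thesis
      using set by (simp add: id_outside_supp perm_restrict_simps)
  qed
  then have "cycle_of_list cs = perm_restrict f C"
    by blast
  then show ?thesis
    using sign_cycle_of_list[OF _ dist] n0 card by (auto simp: cs_def)
qed

text \<open>The forward orbit of a point of \<open>Y\<close> is again mapped into itself. Either it
  is all of \<open>Y\<close>, so that the point lies in its own orbit and \<open>Y\<close> is a
  cycle, or it is a smaller set to which induction applies.\<close>

lemma ex_cyclic_on:
  assumes "finite Y" "Y \<noteq> {}" "f ` Y \<subseteq> Y"
  shows "\<exists>C\<subseteq>Y. cyclic_on f C"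
  using assms
proof (induction Y rule: finite_psubset_induct)
  case (psubset Y)
  then obtain s where s: "s \<in> Y"
    by blast
  have sub: "orbit f s \<subseteq> Y"
  proof
    fix t
    assume "t \<in> orbit f s"
    then show "t \<in> Y"
      by induction (use s psubset.prems in auto)
  qed
  show ?case
  proof (cases "orbit f s = Y")
    case True
    then show ?thesis
      using s by (auto simp: cyclic_on_def)
  next
    case False
    with sub have "\<exists>C\<subseteq>orbit f s. cyclic_on f C"
      by (intro psubset.IH) (auto simp: orbit_nonempty orbit.step)
    with sub show ?thesis
      by blast
  qed
qed

lemma perm_restrict_permutes: "bij_betw f J J \<Longrightarrow> perm_restrict f J permutes J"
  by (rule bij_imp_permutes) (auto simp: perm_restrict_simps cong: bij_betw_cong)

text \<open>The subsets permuted by \<open>f\<close> are the unions of its cycles; adding or removing one fixed cycle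
  is an involution that reverses the sign of the summand.\<close>

lemma sum_sign_permuted_subsets:
  assumes "finite Y" "Y \<noteq> {}" "f ` Y \<subseteq> Y"
  shows "(\<Sum>J | J \<subseteq> Y \<and> bij_betw f J J. (- 1) ^ card J * sign (perm_restrict f J)) = 0"
proof -
  obtain C where C: "C \<subseteq> Y" "cyclic_on f C"
    using ex_cyclic_on[OF assms] by blast
  obtain s where s: "s \<in> C"
    using C by (auto simp: cyclic_on_def)
  let ?S = "{J. J \<subseteq> Y \<and> bij_betw f J J}"
  let ?g = "\<lambda>J. (- 1) ^ card J * sign (perm_restrict f J)"
  have finS: "finite ?S"
    using assms(1) by (auto intro: finite_subset[of _ "Pow Y"])
  have bijC: "bij_betw f C C"
    by (rule cyclic_on_bij_betw[OF C(2)])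
  \<comment> \<open>A permuted set that meets \<open>C\<close> is closed under \<open>f\<close>, and
    \<open>C\<close> is the orbit of each of its points. So a single point \<open>s\<close> decides
    between containing \<open>C\<close> and being disjoint from it.\<close>
  have sub: "C \<subseteq> J" if J: "J \<in> ?S" "t \<in> C" "t \<in> J" for J t
  proof -
    have "x \<in> J" if "x \<in> orbit f t" for x
      using that by induction (use J in \<open>auto simp: bij_betw_def\<close>)
    then show ?thesis
      using orbit_cyclic_eq3[OF C(2) J(2)] by blast
  qed
  have disj: "J \<inter> C = {}" if "J \<in> ?S" "s \<notin> J" for J
    using sub[OF that(1)] s that(2) by blast
  have un: "J \<union> C \<in> ?S" if "J \<in> ?S" "s \<notin> J" for J
    using that disj[OF that] C(1) bijC by (auto intro: bij_betw_combine)
  have diff: "J - C \<in> ?S" if J: "J \<in> ?S" "s \<in> J" for J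
  proof -
    have "C \<subseteq> J"
      using sub[OF J(1) s J(2)] .
    then have "f ` (J - C) = f ` J - f ` C"
      using J by (intro inj_on_image_set_diff[of f J]) (auto simp: bij_betw_def)
    then show ?thesis
      using J bijC by (auto simp: bij_betw_def intro: inj_on_subset)
  qed
  \<comment> \<open>The factor \<open>(- 1) ^ card C\<close> occurs twice, once from the cardinality
    and once from the sign of the cycle, and only the minus sign of the cycle survives.\<close>
  have neg: "?g (J \<union> C) = - ?g J" if J: "J \<in> ?S" "s \<notin> J" for J
  proof -
    have fin: "finite J" "finite C"
      using J C assms(1) by (auto intro: finite_subset)
    have "perm_restrict f (J \<union> C) = perm_restrict f J \<circ> perm_restrict f C"
      using disj[OF J] C(2) by (simp add: perm_restrict_comp)
    moreover have "permutation (perm_restrict f J)" "permutation (perm_restrict f C)"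
      using perm_restrict_permutes[of f J] perm_restrict_permutes[OF bijC] J fin
      by (auto simp: permutation_permutes)
    ultimately have "sign (perm_restrict f (J \<union> C)) = - sign (perm_restrict f J) * (- 1) ^ card C"
      by (simp add: sign_compose sign_cyclic_on[OF C(2)])
    moreover have "card (J \<union> C) = card J + card C"
      using disj[OF J] fin by (simp add: card_Un_disjoint)
    ultimately show ?thesis
      by (simp add: power_add flip: power_mult_distrib)
  qed
  have "sum ?g ?S = sum ?g {J \<in> ?S. s \<in> J} + sum ?g {J \<in> ?S. s \<notin> J}"
    using finS by (subst sum.union_disjoint[symmetric]) (auto intro!: sum.cong elim!: rev_finite_subset)
  also have "sum ?g {J \<in> ?S. s \<in> J} = (\<Sum>J\<in>{J \<in> ?S. s \<notin> J}. ?g (J \<union> C))"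
  proof (rule sum.reindex_bij_witness[where i = "\<lambda>J. J \<union> C" and j = "\<lambda>J. J - C"])
    fix J
    assume "J \<in> {J \<in> ?S. s \<in> J}"
    then show "J - C \<union> C = J" "J - C \<in> {J \<in> ?S. s \<notin> J}"
        "?g (J - C \<union> C) = ?g J"
      using sub[of J s] diff[of J] s by (auto simp: Un_absorb2)
  next
    fix J
    assume "J \<in> {J \<in> ?S. s \<notin> J}"
    then show "J \<union> C - C = J" "J \<union> C \<in> {J \<in> ?S. s \<in> J}"
      using disj[of J] un[of J] s by auto
  qed
  also have "\<dots> = - sum ?g {J \<in> ?S. s \<notin> J}"
    using neg by (auto simp: sum_negf[symmetric] intro!: sum.cong)
  finally show ?thesis
    by simp
qed

subsection \<open>Reduction modulo the ideal\<close>

text \<open>The monomial \<open>q^k\<close> for integer \<open>k\<close>, so that exponents of both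
  signs can be added before any case distinction.\<close>

definition qpow :: "int \<Rightarrow> laurent"
  where "qpow k = Poly_Mapping.single (0, k) 1"

lemma qpow_0 [simp]: "qpow 0 = 1"
  by (simp add: qpow_def flip: zero_prod_def)

lemma qpow_add: "qpow (i + j) = qpow i * qpow j"
  by (simp add: qpow_def mult_single)

lemma K_q_power: "K_q ^ n = qpow (int n)"
  by (induction n) (simp_all add: qpow_add, simp add: K_q_def qpow_def)

lemma K_qinv_power: "K_qinv ^ n = qpow (- int n)"
proof (induction n)
  case (Suc n)
  have "qpow (- int (Suc n)) = qpow (- 1) * qpow (- int n)"
    by (simp flip: qpow_add)
  with Suc show ?case
    by (simp add: K_qinv_def qpow_def)
qed simp

lemma bw_term_mult: "bw_term c \<alpha> \<star> bw_term d \<beta> = bw_term (c * d) (\<alpha> @ \<beta>)"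
proof
  fix \<gamma>
  have "(bw_term c \<alpha> \<star> bw_term d \<beta>) \<gamma> =
      (\<Sum>p \<in> {(\<beta>, \<gamma>'). \<beta> @ \<gamma>' = \<gamma>}. if p = (\<alpha>, \<beta>) then c * d else 0)"
    unfolding bw_mult_def by (rule sum.cong) (auto simp: bw_term_def split: if_splits)
  then show "(bw_term c \<alpha> \<star> bw_term d \<beta>) \<gamma> = bw_term (c * d) (\<alpha> @ \<beta>) \<gamma>"
    by (auto simp: bw_term_def finite_splits)
qed

lemma bw_mult_diff_right: "E \<star> (\<lambda>\<gamma>. F \<gamma> - G \<gamma>) = (\<lambda>\<gamma>. (E \<star> F) \<gamma> - (E \<star> G) \<gamma>)"
  by (simp add: bw_mult_def split_def right_diff_distrib sum_subtractf)

lemma bw_mult_diff_left: "(\<lambda>\<gamma>. F \<gamma> - G \<gamma>) \<star> E = (\<lambda>\<gamma>. (F \<star> E) \<gamma> - (G \<star> E) \<gamma>)"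
  by (simp add: bw_mult_def split_def left_diff_distrib sum_subtractf)

lemma bw_term_carrier: "\<alpha> \<in> biwords r \<Longrightarrow> bw_term c \<alpha> \<in> carrier (bw_algebra r)"
  by (auto simp: bw_algebra_def bw_term_def intro: finite_subset[of _ "{\<alpha>}"] split: if_splits)

lemma I_SF_q_zero: "(\<lambda>_. 0) \<in> I_SF_q r"
  using additive_subgroup.zero_closed[OF ideal.axioms(1)[OF I_SF_q_ideal[of r]]]
  by (simp add: bw_algebra_def)

lemma I_SF_q_add:
  "E \<in> I_SF_q r \<Longrightarrow> F \<in> I_SF_q r \<Longrightarrow> (\<lambda>\<gamma>. E \<gamma> + F \<gamma>) \<in> I_SF_q r"
  using additive_subgroup.a_closed[OF ideal.axioms(1)[OF I_SF_q_ideal[of r]]]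
  by (simp add: bw_algebra_def)

lemma I_SF_q_sum:
  "(\<And>i. i \<in> A \<Longrightarrow> E i \<in> I_SF_q r) \<Longrightarrow> (\<lambda>\<gamma>. \<Sum>i\<in>A. E i \<gamma>) \<in> I_SF_q r"
  by (induction A rule: infinite_finite_induct) (auto simp: I_SF_q_zero I_SF_q_add)

lemma I_SF_q_mult_left: "E \<in> I_SF_q r \<Longrightarrow> \<alpha> \<in> biwords r \<Longrightarrow> bw_term c \<alpha> \<star> E \<in> I_SF_q r"
  using ideal.I_l_closed[OF I_SF_q_ideal, of E r, OF _ bw_term_carrier, of \<alpha> c]
  by (simp add: bw_algebra_def)

lemma I_SF_q_mult_right: "E \<in> I_SF_q r \<Longrightarrow> \<alpha> \<in> biwords r \<Longrightarrow> E \<star> bw_term c \<alpha> \<in> I_SF_q r"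
  using ideal.I_r_closed[OF I_SF_q_ideal, of E r, OF _ bw_term_carrier, of \<alpha> c]
  by (simp add: bw_algebra_def)

lemma I_SF_q_scale:
  assumes "(\<lambda>\<gamma>. bw_term c \<alpha> \<gamma> - bw_term d \<beta> \<gamma>) \<in> I_SF_q r"
  shows "(\<lambda>\<gamma>. bw_term (k * c) \<alpha> \<gamma> - bw_term (k * d) \<beta> \<gamma>) \<in> I_SF_q r"
  using I_SF_q_mult_left[OF assms, of "[]" k]
  by (simp add: bw_mult_diff_right bw_term_mult biwords_def)

text \<open>The exponents 0, 1, 2 of the three rules are the values of one formula, which has the
  shape of the change of inversions under an adjacent swap.\<close>

lemma rule_diff_in_I_SF_q:
  assumes "{x, y, a, b} \<subseteq> {1..r}" "y < x"
  shows "(\<lambda>\<gamma>. bw_term 1 [(x, a), (y, b)] \<gamma> -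
    bw_term (qpow (1 + of_bool (a < b) - of_bool (b < a))) [(y, b), (x, a)] \<gamma>) \<in> I_SF_q r"
proof -
  have "([(x, a), (y, b)], qpow (1 + of_bool (a < b) - of_bool (b < a)), [(y, b), (x, a)]) \<in> SF_q r"
  proof (cases a b rule: linorder_cases)
    case less
    then show ?thesis
      using SF_q.intros(3)[of x r y a b] assms by (simp add: K_q_power)
  next
    case equal
    then show ?thesis
      using SF_q.intros(2)[of x r y a b] assms K_q_power[of 1] by simp
  next
    case greater
    then show ?thesis
      using SF_q.intros(1)[of x r y a b] assms by simp
  qed
  then have "(\<lambda>\<gamma>. bw_term 1 [(x, a), (y, b)] \<gamma> -
      bw_term (qpow (1 + of_bool (a < b) - of_bool (b < a))) [(y, b), (x, a)] \<gamma>)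
      \<in> rule_diffs (SF_q r)"
    unfolding rule_diffs_def by blast
  then show ?thesis
    unfolding I_SF_q_def
    using ring.genideal_self[OF bw_algebra_ring rule_diffs_carrier] by blast
qed

text \<open>The ideal is two-sided, so a rule can be multiplied by \<open>u\<close> on the left and
  by \<open>v\<close> on the right.\<close>

lemma swap_in_I_SF_q:
  assumes "u @ (x, a) # (y, b) # v \<in> biwords r" "y < x"
  shows "(\<lambda>\<gamma>. bw_term 1 (u @ (x, a) # (y, b) # v) \<gamma> -
    bw_term (qpow (1 + of_bool (a < b) - of_bool (b < a))) (u @ (y, b) # (x, a) # v) \<gamma>)
    \<in> I_SF_q r"
proof -
  have "{x, y, a, b} \<subseteq> {1..r}" and uv: "u \<in> biwords r" "v \<in> biwords r"
    using assms(1) by (auto simp: biwords_def)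
  from rule_diff_in_I_SF_q[OF this(1) assms(2)]
  show ?thesis
    using I_SF_q_mult_right[OF I_SF_q_mult_left[OF _ uv(1), of _ 1] uv(2), of _ 1]
    by (fastforce simp: bw_mult_diff_right bw_mult_diff_left bw_term_mult)
qed

section \<open>Stable sorting by the top word as normal form\<close>

lemma mset_eq_if_blocks_eq:
  assumes "\<And>k. filter (\<lambda>x. f x = k) xs = filter (\<lambda>x. f x = k) ys"
  shows "mset xs = mset ys"
proof (rule multiset_eqI)
  fix x
  have "count (mset zs) x = count (mset (filter (\<lambda>z. f z = f x) zs)) x" for zs
    by simp
  then show "count (mset xs) x = count (mset ys) x"
    using assms by metis
qed

text \<open>A stable sort leaves the order inside each block of equal keys unchanged, so its output
  is the sorted list with the same blocks.\<close>

lemma sort_key_eqI: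
  assumes "\<And>k. filter (\<lambda>x. f x = k) xs = filter (\<lambda>x. f x = k) ys" "sorted (map f ys)"
  shows "sort_key f xs = ys"
proof (rule properties_for_sort_key)
  show "mset ys = mset xs"
    using mset_eq_if_blocks_eq[of f xs ys] assms(1) by simp
  show "filter (\<lambda>x. f k = f x) ys = filter (\<lambda>x. f k = f x) xs" for k
    using assms(1)[of "f k"] by (metis (mono_tags, lifting) filter_cong)
qed (use assms in simp)

lemma sort_key_swap:
  assumes "f a \<noteq> f b"
  shows "sort_key f (u @ a # b # v) = sort_key f (u @ b # a # v)"
  by (rule sort_key_eqI) (use assms in \<open>auto simp: sort_key_stable\<close>)

text \<open>Swapping \<open>(x, a) (y, b)\<close> with \<open>x > y\<close> lowers \<open>inv top\<close> by 1 and changes \<open>inv bottom\<close> by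
  \<open>[a < b] - [a > b]\<close>, and the exponent of \<open>q\<close> in the rule is exactly the sum of these two
  changes. So \<open>q^(inv bottom - inv top)\<close> times the biword is invariant under the rules.\<close>

lemma biword_reduces_to_sort:
  assumes "\<alpha> \<in> biwords r"
  shows "(\<lambda>\<gamma>. bw_term 1 \<alpha> \<gamma> -
      bw_term (qpow (int (inv_word (map fst \<alpha>)) - int (inv_word (map snd \<alpha>))
        + int (inv_word (map snd (sort_key fst \<alpha>))))) (sort_key fst \<alpha>) \<gamma>) \<in> I_SF_q r"
  using assms
proof (induction "inv_word (map fst \<alpha>)" arbitrary: \<alpha> rule: less_induct)
  case less
  show ?case
  proof (cases "sorted (map fst \<alpha>)")
    case True
    then have "sort_key fst \<alpha> = \<alpha>"
      by (intro sort_key_eqI) auto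
    then show ?thesis
      using True by (simp add: inv_word_sorted I_SF_q_zero)
  next
    case False
    then obtain u p p' v where "\<alpha> = u @ p # p' # v" "fst p' < fst p"
      by (rule not_sorted_descentE)
    then obtain x a y b where \<alpha>: "\<alpha> = u @ (x, a) # (y, b) # v" and xy: "y < x"
      by (metis prod.collapse)
    define \<beta> where "\<beta> = u @ (y, b) # (x, a) # v"
    let ?n = "\<lambda>\<alpha>. int (inv_word (map fst \<alpha>)) - int (inv_word (map snd \<alpha>))
        + int (inv_word (map snd (sort_key fst \<alpha>)))"
    define k :: int where "k = 1 + of_bool (a < b) - of_bool (b < a)"
    have sort: "sort_key fst \<alpha> = sort_key fst \<beta>"
      unfolding \<alpha> \<beta>_def by (rule sort_key_swap) (use xy in simp)
    have top: "int (inv_word (map fst \<alpha>)) = int (inv_word (map fst \<beta>)) + 1"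
      using inv_word_swap[of "map fst u" x y "map fst v"] xy by (simp add: \<alpha> \<beta>_def)
    have n: "?n \<alpha> = k + ?n \<beta>"
      using top inv_word_swap[of "map snd u" a b "map snd v"]
      unfolding sort by (simp add: \<alpha> \<beta>_def k_def)
    have "\<beta> \<in> biwords r"
      using less.prems by (auto simp: \<alpha> \<beta>_def biwords_def)
    then have "(\<lambda>\<gamma>. bw_term 1 \<beta> \<gamma> - bw_term (qpow (?n \<beta>)) (sort_key fst \<beta>) \<gamma>) \<in> I_SF_q r"
      using top by (intro less.hyps) auto
    \<comment> \<open>The induction hypothesis for \<open>\<beta>\<close> is multiplied by the
      coefficient \<open>q^k\<close> of the swap and then chained with the swap itself.\<close>
    from I_SF_q_scale[OF this, of "qpow k"]
    have "(\<lambda>\<gamma>. bw_term (qpow k) \<beta> \<gamma> - bw_term (qpow (?n \<alpha>)) (sort_key fst \<alpha>) \<gamma>) \<in> I_SF_q r"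
      unfolding n by (simp add: qpow_add sort)
    moreover have "(\<lambda>\<gamma>. bw_term 1 \<alpha> \<gamma> - bw_term (qpow k) \<beta> \<gamma>) \<in> I_SF_q r"
      using swap_in_I_SF_q[of u x a y b v r] less.prems xy by (simp add: \<alpha> \<beta>_def k_def)
    ultimately show ?thesis
      using I_SF_q_add by fastforce
  qed
qed

subsection \<open>The product of the two series\<close>

definition ferm_index :: "nat \<Rightarrow> (nat set \<times> (nat \<Rightarrow> nat)) set"
  where "ferm_index r = Sigma (Pow {1..r}) (\<lambda>J. {\<sigma>. \<sigma> permutes J})"

definition ferm_coeff :: "nat set \<times> (nat \<Rightarrow> nat) \<Rightarrow> laurent"
  where "ferm_coeff = (\<lambda>(J, \<sigma>). (- 1) ^ card J *
    (K_t ^ exc (perm_biword J \<sigma>) * (- K_qinv) ^ inv_perm J \<sigma>))"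

definition bos_biword :: "nat list \<Rightarrow> biword"
  where "bos_biword w = zip (sort w) w"

definition bos_coeff :: "nat list \<Rightarrow> laurent"
  where "bos_coeff w = K_t ^ exc (bos_biword w) * K_q ^ inv_word w"

definition product_biword :: "(nat set \<times> (nat \<Rightarrow> nat)) \<times> nat list \<Rightarrow> biword"
  where "product_biword = (\<lambda>((J, \<sigma>), w). perm_biword J \<sigma> @ bos_biword w)"

definition product_index :: "nat \<Rightarrow> ((nat set \<times> (nat \<Rightarrow> nat)) \<times> nat list) set"
  where "product_index r = ferm_index r \<times> lists {1..r}"

lemma map_fst_bos_biword [simp]: "map fst (bos_biword w) = sort w"
  and map_snd_bos_biword [simp]: "map snd (bos_biword w) = w"
  and length_bos_biword [simp]: "length (bos_biword w) = length w"
  by (simp_all add: bos_biword_def)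

lemma bos_biword_eq_Nil_iff [simp]: "bos_biword w = [] \<longleftrightarrow> w = []"
  by (metis length_0_conv length_bos_biword)

lemma map_fst_perm_biword [simp]: "map fst (perm_biword J \<sigma>) = map \<sigma> (sorted_list_of_set J)"
  and map_snd_perm_biword [simp]: "map snd (perm_biword J \<sigma>) = sorted_list_of_set J"
  by (simp_all add: perm_biword_def comp_def)

lemma finite_permutes_subset: "finite A \<Longrightarrow> J \<subseteq> A \<Longrightarrow> finite {\<sigma>. \<sigma> permutes J}"
  by (blast intro: finite_permutations finite_subset)

lemma finite_ferm_index: "finite (ferm_index r)"
  unfolding ferm_index_def by (intro finite_SigmaI) (auto intro: finite_permutes_subset[OF finite_atLeastAtMost])

lemma finite_product_index: "finite {\<tau> \<in> product_index r. length (product_biword \<tau>) = n}"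
proof (rule finite_subset)
  show "{\<tau> \<in> product_index r. length (product_biword \<tau>) = n} \<subseteq>
      ferm_index r \<times> {w. set w \<subseteq> {1..r} \<and> length w \<le> n}"
    by (auto simp: product_index_def product_biword_def)
  show "finite (ferm_index r \<times> {w. set w \<subseteq> {1..r} \<and> length w \<le> n})"
    by (intro finite_cartesian_product finite_ferm_index finite_lists_length_le) simp
qed

text \<open>Written as one finite sum of single-term series, the factor can be multiplied term by
  term.\<close>

lemma Ferm_eq_sum:
  "Ferm r \<beta> = (\<Sum>i\<in>ferm_index r. bw_term (ferm_coeff i) (perm_biword (fst i) (snd i)) \<beta>)"
proof -
  have fin: "finite {\<sigma>. \<sigma> permutes J}" if "J \<subseteq> {1..r}" for J
    using that by (rule finite_permutes_subset[OF finite_atLeastAtMost])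
  have "Ferm r \<beta> = (\<Sum>J\<in>Pow {1..r}. \<Sum>\<sigma>\<in>{\<sigma>. \<sigma> permutes J}.
      bw_term (ferm_coeff (J, \<sigma>)) (perm_biword J \<sigma>) \<beta>)"
    unfolding Ferm_def formal_sum_def
  proof (rule sum.cong[OF refl])
    fix J
    assume "J \<in> Pow {1..r}"
    then have "finite {\<sigma>. \<sigma> permutes J}"
      using fin by blast
    then show "(- 1) ^ card J * (\<Sum>\<sigma>\<in>{\<sigma> \<in> {\<sigma>. \<sigma> permutes J}. perm_biword J \<sigma> = \<beta>}.
          K_t ^ exc (perm_biword J \<sigma>) * (- K_qinv) ^ inv_perm J \<sigma>) =
        (\<Sum>\<sigma>\<in>{\<sigma>. \<sigma> permutes J}. bw_term (ferm_coeff (J, \<sigma>)) (perm_biword J \<sigma>) \<beta>)"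
      by (subst sum.inter_filter)
        (auto simp: sum_distrib_left bw_term_def ferm_coeff_def intro!: sum.cong)
  qed
  also have "\<dots> = (\<Sum>i\<in>ferm_index r. bw_term (ferm_coeff i) (perm_biword (fst i) (snd i)) \<beta>)"
    unfolding ferm_index_def by (subst sum.Sigma) (auto simp: fin split_def)
  finally show ?thesis .
qed

text \<open>Only words as long as \<open>\<gamma>\<close> contribute. The bound \<open>n\<close>
  lets one finite index set serve all right factors of a biword of length \<open>n\<close>.\<close>

lemma Bos_eq_sum:
  assumes "length \<gamma> \<le> n"
  shows "Bos r \<gamma> =
    (\<Sum>w | set w \<subseteq> {1..r} \<and> length w \<le> n. bw_term (bos_coeff w) (bos_biword w) \<gamma>)"
proof -
  let ?W = "{w. set w \<subseteq> {1..r} \<and> length w \<le> n}"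
  have fin: "finite ?W"
    by (rule finite_lists_length_le) simp
  have "{w \<in> lists {1..r}. zip (sort w) w = \<gamma>} = {w \<in> ?W. bos_biword w = \<gamma>}"
    using assms by (auto simp: bos_biword_def)
  then have "Bos r \<gamma> = (\<Sum>w\<in>{w \<in> ?W. bos_biword w = \<gamma>}. bos_coeff w)"
    by (simp add: Bos_def formal_sum_def bos_coeff_def bos_biword_def)
  also have "\<dots> = (\<Sum>w\<in>?W. bw_term (bos_coeff w) (bos_biword w) \<gamma>)"
    using fin unfolding bw_term_def by (subst sum.inter_filter) (auto intro: sum.cong)
  finally show ?thesis .
qed

text \<open>At a biword of length \<open>n\<close> both factors become finite sums of single terms.
  Exchanging these sums with the sum over factorizations leaves products of single terms, and those
  of another length vanish there.\<close>

lemma hom_component_Ferm_Bos: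
  "hom_component n (Ferm r \<star> Bos r) =
    (\<lambda>\<alpha>. \<Sum>\<tau> | \<tau> \<in> product_index r \<and> length (product_biword \<tau>) = n.
      bw_term (ferm_coeff (fst \<tau>) * bos_coeff (snd \<tau>)) (product_biword \<tau>) \<alpha>)"
proof
  fix \<alpha> :: biword
  let ?T = "{\<tau>. \<tau> \<in> product_index r \<and> length (product_biword \<tau>) = n}"
  let ?W = "{w. set w \<subseteq> {1..r} \<and> length w \<le> n}"
  let ?g = "\<lambda>\<tau>. bw_term (ferm_coeff (fst \<tau>) * bos_coeff (snd \<tau>)) (product_biword \<tau>) \<alpha>"
  let ?F = "\<lambda>i. bw_term (ferm_coeff i) (perm_biword (fst i) (snd i))"
  let ?B = "\<lambda>w. bw_term (bos_coeff w) (bos_biword w)"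
  have finW: "finite ?W"
    by (rule finite_lists_length_le) simp
  show "hom_component n (Ferm r \<star> Bos r) \<alpha> = sum ?g ?T"
  proof (cases "length \<alpha> = n")
    case False
    then have "?g \<tau> = 0" if "\<tau> \<in> ?T" for \<tau>
      using that by (auto simp: bw_term_def)
    then show ?thesis
      using False by (simp add: hom_component_def)
  next
    case True
    have "(Ferm r \<star> Bos r) \<alpha> =
        (\<Sum>p \<in> {(\<beta>, \<gamma>). \<beta> @ \<gamma> = \<alpha>}. (\<Sum>i\<in>ferm_index r. ?F i (fst p)) * (\<Sum>w\<in>?W. ?B w (snd p)))"
      unfolding bw_mult_def using True by (auto simp: Ferm_eq_sum Bos_eq_sum[of _ n] intro!: sum.cong)
    also have "\<dots> = (\<Sum>p \<in> {(\<beta>, \<gamma>). \<beta> @ \<gamma> = \<alpha>}.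
        \<Sum>\<tau>\<in>ferm_index r \<times> ?W. ?F (fst \<tau>) (fst p) * ?B (snd \<tau>) (snd p))"
      by (simp add: sum_product sum.cartesian_product split_def)
    also have "\<dots> = (\<Sum>\<tau>\<in>ferm_index r \<times> ?W. (?F (fst \<tau>) \<star> ?B (snd \<tau>)) \<alpha>)"
      unfolding bw_mult_def split_def by (rule sum.swap)
    also have "\<dots> = sum ?g (ferm_index r \<times> ?W)"
      by (simp add: bw_term_mult product_biword_def split_def)
    also have "\<dots> = sum ?g ?T"
      using True finite_ferm_index finW
      by (intro sum.mono_neutral_right)
        (auto simp: product_index_def product_biword_def bw_term_def)
    finally show ?thesis
      using True by (simp add: hom_component_def)
  qed
qed

section \<open>Exponents of the reduced product terms\<close>

lemma exc_eq_filter: "exc \<alpha> = length (filter (\<lambda>p. fst p < snd p) \<alpha>)"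
  by (simp add: exc_def length_filter_conv_card)

lemma exc_append: "exc (\<alpha> @ \<beta>) = exc \<alpha> + exc \<beta>"
  by (simp add: exc_eq_filter)

lemma exc_sort_key: "exc (sort_key f \<alpha>) = exc \<alpha>"
  unfolding exc_eq_filter by (metis mset_filter mset_sort size_mset)

lemma mset_map_permutes_sorted_list:
  assumes "\<sigma> permutes J"
  shows "mset (map \<sigma> (sorted_list_of_set J)) = mset (sorted_list_of_set J)"
proof (cases "finite J")
  case True
  have "mset (map \<sigma> (sorted_list_of_set J)) = mset_set (set (map \<sigma> (sorted_list_of_set J)))"
    using assms by (intro mset_set_set[symmetric]) (simp add: distinct_map permutes_inj_on)
  also have "\<dots> = mset_set (set (sorted_list_of_set J))"
    using assms True by (simp add: permutes_image)
  also have "\<dots> = mset (sorted_list_of_set J)"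
    by (intro mset_set_set) simp
  finally show ?thesis .
qed simp

text \<open>Inversions with one letter in each factor depend only on the contents of the factors, so
  they cancel in the difference.\<close>

lemma inv_word_append_rearranged:
  assumes "mset u = mset u'" "mset v = mset v'"
  shows "int (inv_word (u @ v)) - int (inv_word (u' @ v')) =
    int (inv_word u) + int (inv_word v) - int (inv_word u') - int (inv_word v')"
proof -
  have "length (filter P v) = length (filter P v')" for P
    by (metis assms(2) mset_filter size_mset)
  moreover have "sum_list (map g u) = sum_list (map g u')" for g :: "nat \<Rightarrow> nat"
    by (metis assms(1) mset_map sum_mset_sum_list)
  ultimately show ?thesis
    by (simp add: inv_word_append)
qed

lemma product_biword_in_biwords: "\<tau> \<in> product_index r \<Longrightarrow> product_biword \<tau> \<in> biwords r"
proof -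
  assume "\<tau> \<in> product_index r"
  then obtain J \<sigma> w where \<tau>: "\<tau> = ((J, \<sigma>), w)" and J: "J \<subseteq> {1..r}" "\<sigma> permutes J"
    and w: "set w \<subseteq> {1..r}"
    by (auto simp: product_index_def ferm_index_def)
  have "finite J"
    using J by (auto intro: finite_subset)
  then have "perm_biword J \<sigma> \<in> biwords r"
    using J by (auto simp: perm_biword_def biwords_def permutes_in_image subset_iff)
  moreover have "bos_biword w \<in> biwords r"
    using w by (auto simp: bos_biword_def biwords_def subset_iff dest: set_zip_leftD set_zip_rightD)
  ultimately show ?thesis
    by (simp add: \<tau> product_biword_def biwords_def)
qed

text \<open>The part of a reduced coefficient common to all triples with the same sorted biword;
  \<open>fiber_sign\<close> is the part that varies.\<close>

definition fiber_coeff :: "biword \<Rightarrow> laurent"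
  where "fiber_coeff \<beta> = K_t ^ exc \<beta> * K_q ^ inv_word (map snd \<beta>)"

definition fiber_sign :: "(nat set \<times> (nat \<Rightarrow> nat)) \<times> nat list \<Rightarrow> int"
  where "fiber_sign = (\<lambda>((J, \<sigma>), w). (- 1) ^ card J * sign \<sigma>)"

text \<open>The \<open>q\<close>-exponent of the reduced term depends on \<open>\<beta>\<close> only: both rows of the fermionic factor
  have the content of \<open>J\<close> and both rows of the bosonic factor have the content of \<open>w\<close>, so the
  inversions between the two factors agree in the top and the bottom row.\<close>

lemma product_term_reduces:
  assumes "\<tau> \<in> product_index r"
  shows "(\<lambda>\<gamma>. bw_term (ferm_coeff (fst \<tau>) * bos_coeff (snd \<tau>)) (product_biword \<tau>) \<gamma> -
      bw_term (of_int (fiber_sign \<tau>) * fiber_coeff (sort_key fst (product_biword \<tau>)))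
        (sort_key fst (product_biword \<tau>)) \<gamma>) \<in> I_SF_q r"
proof -
  obtain J \<sigma> w where \<tau>: "\<tau> = ((J, \<sigma>), w)" and J: "J \<subseteq> {1..r}" "\<sigma> permutes J"
    using assms by (auto simp: product_index_def ferm_index_def)
  have "finite J"
    using J by (auto intro: finite_subset)
  define \<alpha> where "\<alpha> = product_biword \<tau>"
  define \<beta> where "\<beta> = sort_key fst \<alpha>"
  define n where "n = int (inv_word (map fst \<alpha>)) - int (inv_word (map snd \<alpha>))"
  \<comment> \<open>The bottom row of the fermionic factor and the top row of the bosonic factor are
    sorted, hence without inversions.\<close>
  have n: "n = int (inv_perm J \<sigma>) - int (inv_word w)"
    using inv_word_append_rearranged[OF mset_map_permutes_sorted_list[OF J(2)] mset_sort[of "\<lambda>x. x" w]]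
    by (simp add: n_def \<alpha>_def \<tau> product_biword_def inv_perm_def inv_word_sorted)
  \<comment> \<open>The minus signs of \<open>(- q)^(-1)\<close> collect to the sign of
    \<open>\<sigma>\<close>.\<close>
  have sgn: "(- K_qinv) ^ inv_perm J \<sigma> = of_int (sign \<sigma>) * qpow (- int (inv_perm J \<sigma>))"
    using sign_eq_inv_word[of \<sigma> "sorted_list_of_set J"] J(2) \<open>finite J\<close>
    by (simp add: inv_perm_def power_minus[of K_qinv] K_qinv_power)
  have "qpow (- n) = qpow (- int (inv_perm J \<sigma>)) * qpow (int (inv_word w))"
    by (simp add: n flip: qpow_add)
  then have "ferm_coeff (fst \<tau>) * bos_coeff (snd \<tau>) =
      of_int (fiber_sign \<tau>) * K_t ^ exc \<alpha> * qpow (- n)"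
    by (simp add: \<tau> \<alpha>_def product_biword_def exc_append ferm_coeff_def bos_coeff_def fiber_sign_def
        power_add K_q_power sgn mult_ac)
  then have "ferm_coeff (fst \<tau>) * bos_coeff (snd \<tau>) * qpow (n + int (inv_word (map snd \<beta>))) =
      of_int (fiber_sign \<tau>) * K_t ^ exc \<alpha> * (qpow (- n) * qpow (n + int (inv_word (map snd \<beta>))))"
    by (simp add: mult.assoc)
  also have "\<dots> = of_int (fiber_sign \<tau>) * fiber_coeff \<beta>"
    by (simp add: fiber_coeff_def K_q_power \<beta>_def exc_sort_key mult.assoc flip: qpow_add)
  finally show ?thesis
    using I_SF_q_scale[OF biword_reduces_to_sort[OF product_biword_in_biwords[OF assms]],
        of "ferm_coeff (fst \<tau>) * bos_coeff (snd \<tau>)"]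
    by (simp add: n_def \<alpha>_def \<beta>_def)
qed

section \<open>Fibers over a sorted biword\<close>

lemma filter_eq_distinct: "distinct xs \<Longrightarrow> filter (\<lambda>i. i = a) xs = (if a \<in> set xs then [a] else [])"
  by (induction xs) (auto simp: filter_empty_conv)

text \<open>The top letter \<open>y\<close> stands only above the preimage of \<open>y\<close> under
  \<open>\<sigma>\<close>, so a block of the fermionic factor has at most one letter.\<close>

lemma block_perm_biword:
  assumes "finite J" "\<sigma> permutes J"
  shows "filter (\<lambda>p. fst p = y) (perm_biword J \<sigma>) = (if y \<in> J then [(y, inv_into UNIV \<sigma> y)] else [])"
proof -
  have "filter (\<lambda>p. fst p = y) (perm_biword J \<sigma>) =
      map (\<lambda>i. (\<sigma> i, i)) (filter (\<lambda>i. i = inv_into UNIV \<sigma> y) (sorted_list_of_set J))"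
    using assms(2) by (auto simp: perm_biword_def filter_map comp_def permutes_inverses
        intro!: arg_cong[of _ _ "map _"] filter_cong)
  moreover have "inv_into UNIV \<sigma> y \<in> J \<longleftrightarrow> y \<in> J"
    using permutes_in_image[OF permutes_inv[OF assms(2)]] .
  ultimately show ?thesis
    using assms by (simp add: filter_eq_distinct permutes_inverses)
qed

lemma filter_concat_blocks:
  assumes "distinct ys" "\<And>y p. p \<in> set (B y) \<Longrightarrow> f p = y"
  shows "filter (\<lambda>p. f p = k) (concat (map B ys)) = (if k \<in> set ys then B k else [])"
  using assms(1)
proof (induction ys)
  case (Cons y ys)
  have "filter (\<lambda>p. f p = k) (B y) = (if k = y then B y else [])"
    using assms(2) by (auto simp: filter_id_conv filter_empty_conv)
  with Cons show ?case
    by auto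
qed simp

lemma sorted_concat_blocks:
  assumes "sorted ys" "\<And>y p. p \<in> set (B y) \<Longrightarrow> f p = y"
  shows "sorted (map f (concat (map B ys)))"
  using assms(1)
proof (induction ys)
  case (Cons y ys)
  have "sorted (map f (B y))"
    using sorted_map_same[of f "\<lambda>_. y" "B y"] assms(2) by (simp add: filter_id_conv[THEN iffD2])
  with Cons show ?case
    using assms(2) by (auto simp: sorted_append)
qed simp

text \<open>Stable sorting puts the letter of the fermionic factor with top \<open>y\<close>, whose bottom is
  \<open>\<sigma>^(-1) y\<close>, in front of the block with top \<open>y\<close>. Hence a triple in the fiber over \<open>\<beta>\<close> is
  determined by \<open>J\<close>, and \<open>J\<close> can be any set permuted by the map sending \<open>y\<close> to the first bottom
  letter of its block.\<close>

lemma sum_fiber_sign: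
  assumes "\<beta> \<noteq> []"
  shows "(\<Sum>\<tau> | \<tau> \<in> product_index r \<and> sort_key fst (product_biword \<tau>) = \<beta>. fiber_sign \<tau>) = 0"
    (is "sum _ ?T = 0")
proof (cases "?T = {}")
  case True
  then show ?thesis
    by (metis sum.empty)
next
  case False
  \<comment> \<open>One member of the fiber shows that \<open>\<beta>\<close> is sorted by its top
    word, has two rows of equal content and uses only letters of the alphabet.\<close>
  then obtain J0 \<sigma>0 w0 where \<tau>0: "((J0, \<sigma>0), w0) \<in> product_index r"
    and \<beta>0: "sort_key fst (product_biword ((J0, \<sigma>0), w0)) = \<beta>"
    by auto
  define blk where "blk y = filter (\<lambda>p. fst p = y) \<beta>" for y
  \<comment> \<open>Outside \<open>Y\<close> the block is empty and the value is that of
    \<open>hd []\<close>; below, \<open>f\<close> is applied only to points of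
    \<open>Y\<close>.\<close>
  define f where "f y = snd (hd (blk y))" for y
  define Y where "Y = fst ` set \<beta>"
  \<comment> \<open>\<open>B J y\<close> is the block of \<open>y\<close> after its fermionic
    letter, if there is one, has been taken off the front. Concatenated by increasing
    \<open>y\<close>, these blocks form the candidate \<open>rest J\<close> for the bosonic
    factor.\<close>
  define B where "B J y = (if y \<in> J then tl (blk y) else blk y)" for J y
  define rest where "rest J = concat (map (B J) [1..<Suc r])" for J
  have sorted: "sorted (map fst \<beta>)"
    using \<beta>0 by auto
  have mset\<beta>: "mset \<beta> = mset (product_biword ((J0, \<sigma>0), w0))"
    using \<beta>0 by auto
  have "\<sigma>0 permutes J0"
    using \<tau>0 by (simp add: product_index_def ferm_index_def)
  then have bal: "mset (map fst \<beta>) = mset (map snd \<beta>)"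
    using mset_map_permutes_sorted_list[of \<sigma>0 J0]
    by (simp only: mset_map mset\<beta>) (simp add: product_biword_def flip: mset_map)
  have set\<beta>: "set \<beta> \<subseteq> {1..r} \<times> {1..r}"
    using product_biword_in_biwords[OF \<tau>0] mset_eq_setD[OF mset\<beta>] by (auto simp: biwords_def)
  have Y: "finite Y" "Y \<noteq> {}" "Y \<subseteq> {1..r}"
    using assms set\<beta> by (auto simp: Y_def)
  have blk_Y: "blk y \<noteq> [] \<longleftrightarrow> y \<in> Y" for y
    by (auto simp: blk_def Y_def filter_empty_conv)
  have hd_blk: "hd (blk y) = (y, f y)" "(y, f y) \<in> set \<beta>" if "y \<in> Y" for y
  proof -
    have "hd (blk y) \<in> set (blk y)"
      using that blk_Y by simp
    then show "hd (blk y) = (y, f y)" "(y, f y) \<in> set \<beta>"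
      by (auto simp: blk_def f_def prod_eq_iff)
        (metis prod.collapse)
  qed
  \<comment> \<open>The two rows of \<open>\<beta>\<close> have the same content, so a bottom letter
    is also a top letter.\<close>
  have fY: "f ` Y \<subseteq> Y"
  proof
    fix z
    assume "z \<in> f ` Y"
    then have "z \<in> snd ` set \<beta>"
      using hd_blk(2) by force
    also have "snd ` set \<beta> = Y"
      using mset_eq_setD[OF bal] by (simp add: Y_def)
    finally show "z \<in> Y" .
  qed
  have B_fst: "fst p = y" if "p \<in> set (B J y)" for J y p
  proof -
    have "set (tl (blk y)) \<subseteq> set (blk y)"
      by (cases "blk y") auto
    with that have "p \<in> set (blk y)"
      by (auto simp: B_def split: if_splits)
    then show ?thesis
      by (simp add: blk_def)
  qed
  have blk_rest: "filter (\<lambda>p. fst p = y) (rest J) = B J y" for J y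
  proof -
    \<comment> \<open>Such a block is empty, and \<open>tl [] = []\<close> settles the case
      \<open>y \<in> J\<close>.\<close>
    have "B J y = []" if "y \<notin> {1..r}"
      using that blk_Y[of y] Y(3) by (auto simp: B_def)
    then show ?thesis
      unfolding rest_def by (subst filter_concat_blocks) (auto simp: B_fst simp del: upt_Suc)
  qed
  have sorted_rest: "sorted (map fst (rest J))" for J
    unfolding rest_def by (rule sorted_concat_blocks) (auto simp: B_fst simp del: upt_Suc)
  \<comment> \<open>First direction: comparing blocks recovers \<open>\<sigma>\<close> and
    \<open>w\<close> from \<open>J\<close>. The head of the block of \<open>y \<in> J\<close> is the
    fermionic letter, which gives \<open>f\<close> on \<open>J\<close>, and the tails give the
    bosonic factor.\<close>
  have fiber: "J \<subseteq> Y \<and> bij_betw f J J \<and> perm_restrict f J = inv_into UNIV \<sigma> \<and> bos_biword w = rest J"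
    if \<tau>: "((J, \<sigma>), w) \<in> ?T" for J \<sigma> w
  proof -
    have J: "J \<subseteq> {1..r}" "\<sigma> permutes J"
      using \<tau> by (auto simp: product_index_def ferm_index_def)
    then have "finite J"
      by (auto intro: finite_subset)
    have blk: "blk y = (if y \<in> J then [(y, inv_into UNIV \<sigma> y)] else []) @
        filter (\<lambda>p. fst p = y) (bos_biword w)" for y
    proof -
      have "blk y = filter (\<lambda>p. fst p = y) (product_biword ((J, \<sigma>), w))"
        using \<tau> by (auto simp: blk_def sort_key_stable)
      then show ?thesis
        by (simp add: product_biword_def block_perm_biword[OF \<open>finite J\<close> J(2)])
    qed
    have "J \<subseteq> Y"
    proof
      fix y
      assume "y \<in> J"
      then have "blk y \<noteq> []"
        by (simp add: blk)
      then show "y \<in> Y"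
        by (simp add: blk_Y)
    qed
    moreover have eq: "perm_restrict f J = inv_into UNIV \<sigma>"
    proof
      fix y
      show "perm_restrict f J y = inv_into UNIV \<sigma> y"
        using blk[of y] permutes_not_in[OF permutes_inv[OF J(2)], of y]
        by (simp add: perm_restrict_def f_def)
    qed
    moreover have "bij_betw f J J"
      using permutes_imp_bij[OF permutes_inv[OF J(2)]]
      unfolding eq[symmetric] by (simp add: perm_restrict_simps cong: bij_betw_cong)
    moreover have "bos_biword w = rest J"
    proof -
      have "sort_key fst (bos_biword w) = bos_biword w"
        by (rule sort_key_eqI) auto
      moreover have "sort_key fst (bos_biword w) = rest J"
      proof (rule sort_key_eqI[OF _ sorted_rest])
        show "filter (\<lambda>p. fst p = y) (bos_biword w) = filter (\<lambda>p. fst p = y) (rest J)" for y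
          using blk[of y] by (simp add: blk_rest B_def)
      qed
      ultimately show ?thesis
        by simp
    qed
    ultimately show ?thesis
      by blast
  qed
  \<comment> \<open>Second direction: every set permuted by \<open>f\<close> comes from a triple in
    the fiber.\<close>
  have fiber_section: "((J, inv_into UNIV (perm_restrict f J)), map snd (rest J)) \<in> ?T"
    if J: "J \<subseteq> Y" "bij_betw f J J" for J
  proof -
    let ?\<pi> = "perm_restrict f J" and ?w = "map snd (rest J)"
    have J': "J \<subseteq> {1..r}" "finite J"
      using J Y by (auto intro: finite_subset)
    have \<pi>: "?\<pi> permutes J" "inv_into UNIV ?\<pi> permutes J"
      using perm_restrict_permutes[OF J(2)] permutes_inv by auto
    have inv_inv: "inv_into UNIV (inv_into UNIV ?\<pi>) = ?\<pi>"
      using permutes_inv_inv[OF \<pi>(1)] .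
    have blk: "filter (\<lambda>p. fst p = y) (perm_biword J (inv_into UNIV ?\<pi>) @ rest J) = blk y" for y
    proof (cases "y \<in> J")
      case True
      then have "blk y = (y, f y) # tl (blk y)"
        using J(1) blk_Y[of y] hd_blk(1)[of y] by (metis list.collapse subsetD)
      then show ?thesis
        using True by (simp add: block_perm_biword[OF J'(2) \<pi>(2)] inv_inv blk_rest B_def
            perm_restrict_simps)
    qed (simp add: block_perm_biword[OF J'(2) \<pi>(2)] blk_rest B_def)
    have mset: "mset (perm_biword J (inv_into UNIV ?\<pi>)) + mset (rest J) = mset \<beta>"
      using mset_eq_if_blocks_eq[of fst "perm_biword J (inv_into UNIV ?\<pi>) @ rest J" \<beta>] blk
      by (simp add: blk_def)
    \<comment> \<open>The rows of \<open>\<beta>\<close> and of the fermionic factor have equal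
      content, so the rows of \<open>rest J\<close> do as well. With its sorted top row,
      \<open>rest J\<close> is then the bosonic biword of its bottom row.\<close>
    have "image_mset fst (mset (perm_biword J (inv_into UNIV ?\<pi>))) =
        image_mset snd (mset (perm_biword J (inv_into UNIV ?\<pi>)))"
      using mset_map_permutes_sorted_list[OF \<pi>(2)] by (simp flip: mset_map)
    moreover have "image_mset fst (mset (perm_biword J (inv_into UNIV ?\<pi>)) + mset (rest J)) =
        image_mset snd (mset (perm_biword J (inv_into UNIV ?\<pi>)) + mset (rest J))"
      unfolding mset using bal by simp
    ultimately have "mset (map fst (rest J)) = mset ?w"
      by simp
    then have "sort ?w = map fst (rest J)"
      using sorted_rest by (intro properties_for_sort)
    then have bos: "bos_biword ?w = rest J"
      by (simp add: bos_biword_def zip_map_fst_snd)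
    have "sort_key fst (product_biword ((J, inv_into UNIV ?\<pi>), ?w)) = \<beta>"
      unfolding product_biword_def by (rule sort_key_eqI) (use blk sorted in \<open>auto simp: bos blk_def\<close>)
    moreover have "set (perm_biword J (inv_into UNIV ?\<pi>) @ rest J) = set \<beta>"
      using mset by (intro mset_eq_setD) simp
    then have "set ?w \<subseteq> {1..r}"
      using set\<beta> by force
    ultimately show ?thesis
      using \<pi>(2) J' by (auto simp: product_index_def ferm_index_def)
  qed
  have "(\<Sum>\<tau>\<in>?T. fiber_sign \<tau>) =
      (\<Sum>J | J \<subseteq> Y \<and> bij_betw f J J. (- 1) ^ card J * sign (perm_restrict f J))"
  proof (rule sum.reindex_bij_witness[where j = "\<lambda>\<tau>. fst (fst \<tau>)"
        and i = "\<lambda>J. ((J, inv_into UNIV (perm_restrict f J)), map snd (rest J))"])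
    fix \<tau>
    assume "\<tau> \<in> ?T"
    moreover obtain J \<sigma> w where \<tau>: "\<tau> = ((J, \<sigma>), w)"
      by (metis prod.collapse)
    ultimately have T: "((J, \<sigma>), w) \<in> ?T"
      by simp
    note fib = fiber[OF T]
    have J: "\<sigma> permutes J" "finite J"
      using T by (auto simp: product_index_def ferm_index_def intro: finite_subset)
    have "map snd (rest J) = w"
      using fib by (metis map_snd_bos_biword)
    then show "((fst (fst \<tau>), inv_into UNIV (perm_restrict f (fst (fst \<tau>)))), map snd (rest (fst (fst \<tau>)))) = \<tau>"
      using fib by (simp add: \<tau> permutes_inv_inv[OF J(1)])
    show "fst (fst \<tau>) \<in> {J. J \<subseteq> Y \<and> bij_betw f J J}"
      using fib by (simp add: \<tau>)
    \<comment> \<open>The restriction of \<open>f\<close> is the inverse of \<open>\<sigma>\<close>,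
      and a permutation has the sign of its inverse.\<close>
    have "sign (inv_into UNIV \<sigma>) = sign \<sigma>"
      using J by (intro sign_inverse) (auto simp: permutation_permutes)
    then show "(- 1) ^ card (fst (fst \<tau>)) * sign (perm_restrict f (fst (fst \<tau>))) = fiber_sign \<tau>"
      using fib by (simp add: \<tau> fiber_sign_def)
  next
    fix J
    assume "J \<in> {J. J \<subseteq> Y \<and> bij_betw f J J}"
    then show "((J, inv_into UNIV (perm_restrict f J)), map snd (rest J)) \<in> ?T"
      using fiber_section by blast
  qed simp
  also have "\<dots> = 0"
    by (rule sum_sign_permuted_subsets[OF Y(1,2) fY])
  finally show ?thesis .
qed

section \<open>The congruence, one degree at a time\<close>

theorem mainTheorem1:
  fixes r :: nat
  assumes "r \<ge> 1"
  shows "cong_SF_q r (Ferm r \<star> Bos r) (bw_term 1 [])"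
  unfolding cong_SF_q_def
proof
  fix n
  let ?T = "{\<tau>. \<tau> \<in> product_index r \<and> length (product_biword \<tau>) = n}"
  let ?c = "\<lambda>\<tau>. ferm_coeff (fst \<tau>) * bos_coeff (snd \<tau>)"
  let ?nf = "\<lambda>\<tau>. sort_key fst (product_biword \<tau>)"
  have hom: "hom_component n (\<lambda>\<alpha>. (Ferm r \<star> Bos r) \<alpha> - bw_term 1 [] \<alpha>) =
      (\<lambda>\<alpha>. (\<Sum>\<tau>\<in>?T. bw_term (?c \<tau>) (product_biword \<tau>) \<alpha>) - hom_component n (bw_term 1 []) \<alpha>)"
    unfolding hom_component_Ferm_Bos[symmetric, THEN fun_cong]
    by (auto simp: hom_component_def)
  show "hom_component n (\<lambda>\<alpha>. (Ferm r \<star> Bos r) \<alpha> - bw_term 1 [] \<alpha>) \<in> I_SF_q r"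
  proof (cases "n = 0")
    case True
    \<comment> \<open>In degree 0 only the empty set and the empty word remain, and their term is
      1.\<close>
    have "?T = {(({}, id), [])}"
      using True
      by (auto simp: product_index_def ferm_index_def product_biword_def perm_biword_def
          permutes_empty dest: finite_subset)
    moreover have "?c (({}, id), []) = 1"
      by (simp add: ferm_coeff_def bos_coeff_def perm_biword_def bos_biword_def exc_def inv_perm_def)
    moreover have "product_biword (({}, id), []) = []"
      by (simp add: product_biword_def perm_biword_def)
    ultimately have "(\<Sum>\<tau>\<in>?T. bw_term (?c \<tau>) (product_biword \<tau>) \<alpha>) = bw_term 1 [] \<alpha>" for \<alpha>
      by (simp only: sum.insert sum.empty finite.emptyI empty_iff not_False_eq_True add_0_right)
    moreover have "hom_component n (bw_term 1 []) = bw_term 1 []"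
      using True by (auto simp: hom_component_def bw_term_def)
    ultimately show ?thesis
      unfolding hom by (simp only: diff_self I_SF_q_zero)
  next
    case False
    \<comment> \<open>Grouped by normal form, the reduced terms have coefficient
      \<open>fiber_coeff \<beta>\<close> times the sum of signs over the fiber of
      \<open>\<beta>\<close>. As \<open>n\<close> is positive, \<open>\<beta>\<close> is not empty
      and this sum vanishes.\<close>
    have zero: "(\<Sum>\<tau>\<in>?T. bw_term (of_int (fiber_sign \<tau>) * fiber_coeff (?nf \<tau>)) (?nf \<tau>) \<beta>) = 0"
      for \<beta>
    proof (cases "length \<beta> = n")
      case True
      have "(\<Sum>\<tau>\<in>?T. bw_term (of_int (fiber_sign \<tau>) * fiber_coeff (?nf \<tau>)) (?nf \<tau>) \<beta>) =
          (\<Sum>\<tau>\<in>?T. if ?nf \<tau> = \<beta> then of_int (fiber_sign \<tau>) * fiber_coeff \<beta> else 0)"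
        by (intro sum.cong) (auto simp: bw_term_def)
      also have "\<dots> = (\<Sum>\<tau>\<in>{\<tau> \<in> ?T. ?nf \<tau> = \<beta>}. of_int (fiber_sign \<tau>) * fiber_coeff \<beta>)"
        using finite_product_index by (subst sum.inter_filter) auto
      \<comment> \<open>Sorting preserves length, so the condition on the length follows from
        \<open>length \<beta> = n\<close>.\<close>
      also have "{\<tau> \<in> ?T. ?nf \<tau> = \<beta>} = {\<tau>. \<tau> \<in> product_index r \<and> ?nf \<tau> = \<beta>}"
        using True by auto
      also have "(\<Sum>\<tau>\<in>\<dots>. of_int (fiber_sign \<tau>) * fiber_coeff \<beta>) =
          of_int (\<Sum>\<tau>\<in>{\<tau>. \<tau> \<in> product_index r \<and> ?nf \<tau> = \<beta>}. fiber_sign \<tau>) * fiber_coeff \<beta>"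
        by (simp add: sum_distrib_right)
      also have "\<dots> = 0"
        using True False by (subst sum_fiber_sign) auto
      finally show ?thesis .
    qed (auto simp: bw_term_def intro!: sum.neutral)
    \<comment> \<open>The component differs from the sum of its reduced terms by an element of the
      ideal, and that sum is zero.\<close>
    have "(\<lambda>\<beta>. \<Sum>\<tau>\<in>?T. bw_term (?c \<tau>) (product_biword \<tau>) \<beta> -
        bw_term (of_int (fiber_sign \<tau>) * fiber_coeff (?nf \<tau>)) (?nf \<tau>) \<beta>) \<in> I_SF_q r"
      by (intro I_SF_q_sum product_term_reduces) simp
    moreover have "hom_component n (bw_term 1 []) = (\<lambda>_. 0)"
      using False by (auto simp: hom_component_def bw_term_def)
    ultimately show ?thesis
      unfolding hom by (simp add: sum_subtractf zero)
  qed
qed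

end
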